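(* For every integer $k\ge 2$ there are integers $c=c(k)$ and $n_0=n_0(k)$ such that $F(n,k)=\delta(k)n+c$ for all $n\ge n_0$.
   Context: An oriented graph is a directed graph obtained by orienting each edge of a finite simple graph in exactly one of its two directions (so there are no loops, and at most one directed edge between any two vertices). A directed graph with at least $k+1$ vertices has property $S_k$ if for every $k$-set $B$ of vertices there is a vertex $u$ such that $B$ is contained in the outneighbourhood of $u$ (that is, there is a directed edge from $u$ to every element of $B$). $F(n,k)$ is the minimum number of edges in a graph of order $n$ (i.e. with $n$ vertices) that has an orientation with property $S_k$. $\delta(k)$ is the smallest positive integer $\delta$ such that some (finite) oriented graph with property $S_k$ has a vertex with indegree $\delta$. (It is known that for every $k$ there exist finite oriented graphs with property $S_k$.) *)

theory Defs
  imports
    "Graph_Theory.Pair_Digraph"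
    "HOL-Library.Extended_Nat"
begin

definition simple_graph :: "'a set \<Rightarrow> 'a set set \<Rightarrow> bool" where
  "simple_graph V E \<longleftrightarrow> finite V \<and> (\<forall>e\<in>E. e \<subseteq> V \<and> card e = 2)"

definition orientation :: "'a set \<Rightarrow> 'a set set \<Rightarrow> 'a pair_pre_digraph \<Rightarrow> bool" where
  "orientation V E D \<longleftrightarrow>
     pverts D = V \<and>
     (\<forall>(u, v)\<in>parcs D. {u, v} \<in> E) \<and>
     (\<forall>u v. {u, v} \<in> E \<longrightarrow> ((u, v) \<in> parcs D \<longleftrightarrow> (v, u) \<notin> parcs D))"

definition oriented_graph :: "'a pair_pre_digraph \<Rightarrow> bool" where
  "oriented_graph D \<longleftrightarrow> (\<exists>V E. simple_graph V E \<and> orientation V E D)"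

definition out_neighbourhood :: "'a pair_pre_digraph \<Rightarrow> 'a \<Rightarrow> 'a set" where
  "out_neighbourhood D u = {v. (u, v) \<in> parcs D}"

definition property_S :: "nat \<Rightarrow> 'a pair_pre_digraph \<Rightarrow> bool" where
  "property_S k D \<longleftrightarrow>
     k + 1 \<le> card (pverts D) \<and>
     (\<forall>B. B \<subseteq> pverts D \<and> card B = k \<longrightarrow>
        (\<exists>u\<in>pverts D. B \<subseteq> out_neighbourhood D u))"

text \<open>
  Finite graphs are considered up to isomorphism, so natural numbers suffice as vertices.
  The infimum over the empty set is \<open>\<infinity>\<close>, which is the value of \<open>min_edges n k\<close> when no graph of
  order \<open>n\<close> has an orientation with property \<open>S\<^sub>k\<close>; otherwise the infimum is attained.
\<close>

definition min_edges :: "nat \<Rightarrow> nat \<Rightarrow> enat" where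
  "min_edges n k = Inf {enat (card E) | E.
     \<exists>(V :: nat set) D. simple_graph V E \<and> card V = n \<and>
       orientation V E D \<and> property_S k D}"

text \<open>
  If no oriented graph has property \<open>S\<^sub>k\<close>, then \<open>min_indegree k\<close> is unspecified, but
  \<open>min_edges n k\<close> is \<open>\<infinity>\<close> for all \<open>n\<close>.
\<close>

definition min_indegree :: "nat \<Rightarrow> nat" where
  "min_indegree k = (LEAST \<delta>. 0 < \<delta> \<and>
     (\<exists>(D :: nat pair_pre_digraph) v. oriented_graph D \<and> property_S k D \<and>
        v \<in> pverts D \<and> in_degree (with_proj D) v = \<delta>))"

end

theory Submission
  imports Defs
begin

text \<open>
  Summing indegrees gives \<open>F(n,k) \<ge> \<delta>(k) n\<close>. Conversely, giving a vertex of indegree \<open>d\<close> a twin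
  with the same inneighbours and no outneighbours preserves \<open>S\<^sub>k\<close> and costs \<open>d\<close> arcs. Twinning
  repeatedly a vertex of indegree \<open>\<delta>(k)\<close> in one fixed graph shows \<open>F(n,k) \<le> \<delta>(k) n + O(1)\<close>, so for
  large \<open>n\<close> an extremal graph itself has a vertex of indegree \<open>\<delta>(k)\<close>, and twinning that one gives
  \<open>F(n+1,k) \<le> F(n,k) + \<delta>(k)\<close>. Hence \<open>F(n,k) - \<delta>(k) n\<close> is nonnegative and eventually
  nonincreasing, so eventually constant.

  A graph with \<open>S\<^sub>k\<close> is obtained from pairs \<open>(s, K)\<close> with \<open>s \<in> {0..k\<^sup>2}\<close>, \<open>K \<subseteq> {0..k\<^sup>2}\<close> and
  \<open>|K| \<le> k\<close>, with an arc from \<open>(s, K)\<close> to \<open>(t, L)\<close> whenever \<open>t \<in> K\<close> and \<open>s \<notin> L\<close>: the vertices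
  \<open>(t\<^sub>i, L\<^sub>i)\<close>, \<open>i \<le> k\<close>, are dominated by \<open>(s, {t\<^sub>1, \<dots>, t\<^sub>k})\<close> for any \<open>s \<notin> L\<^sub>1 \<union> \<dots> \<union> L\<^sub>k\<close>.
\<close>

section \<open>Oriented graphs as asymmetric relations\<close>

lemma orientation_imp_asymmetric:
  assumes "simple_graph V E" "orientation V E D"
  shows "finite V" "pverts D = V" "parcs D \<subseteq> V \<times> V"
    "\<And>u v. (u, v) \<in> parcs D \<Longrightarrow> (v, u) \<notin> parcs D"
proof -
  have edge: "{u, v} \<in> E" if "(u, v) \<in> parcs D" for u v
    using assms(2) that by (auto simp: orientation_def)
  show "finite V" "pverts D = V"
    using assms by (simp_all add: simple_graph_def orientation_def)
  show "parcs D \<subseteq> V \<times> V"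
    using edge assms(1) by (fastforce simp: simple_graph_def)
  show "(v, u) \<notin> parcs D" if "(u, v) \<in> parcs D" for u v
    using edge[OF that] that assms(2) by (simp add: orientation_def)
qed

text \<open>Forgetting directions maps arcs onto edges because every edge is a doubleton oriented
  one way. It is injective because no arc occurs with its reverse.\<close>

lemma card_edges_eq_card_arcs:
  assumes "simple_graph V E" "orientation V E D"
  shows "card E = card (parcs D)"
proof -
  have E: "E = (\<lambda>(u, v). {u, v}) ` parcs D"
  proof
    show "E \<subseteq> (\<lambda>(u, v). {u, v}) ` parcs D"
    proof
      fix e assume e: "e \<in> E"
      then have "card e = 2" using assms(1) by (auto simp: simple_graph_def)
      then obtain u v where uv: "e = {u, v}" by (auto simp: card_2_iff)
      then have "(u, v) \<in> parcs D \<or> (v, u) \<in> parcs D"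
        using assms(2) e unfolding orientation_def by blast
      then show "e \<in> (\<lambda>(u, v). {u, v}) ` parcs D"
        using uv by (force simp: insert_commute)
    qed
    show "(\<lambda>(u, v). {u, v}) ` parcs D \<subseteq> E"
      using assms(2) unfolding orientation_def by auto
  qed
  have "inj_on (\<lambda>(u, v). {u, v}) (parcs D)"
    using orientation_imp_asymmetric(4)[OF assms]
    by (auto simp: inj_on_def doubleton_eq_iff)
  then show ?thesis by (simp add: E card_image)
qed

lemma asymmetric_imp_orientation:
  assumes "finite (pverts D)" "parcs D \<subseteq> pverts D \<times> pverts D"
    and asym: "\<And>u v. (u, v) \<in> parcs D \<Longrightarrow> (v, u) \<notin> parcs D"
  shows "\<exists>E. simple_graph (pverts D) E \<and> orientation (pverts D) E D"
proof (intro exI conjI)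
  let ?E = "(\<lambda>(u, v). {u, v}) ` parcs D"
  have "u \<noteq> v" if "(u, v) \<in> parcs D" for u v
    using asym that by blast
  then show "simple_graph (pverts D) ?E"
    using assms(1,2) by (auto simp: simple_graph_def)
  have "(u, v) \<in> parcs D \<longleftrightarrow> (v, u) \<notin> parcs D" if "{u, v} \<in> ?E" for u v
    using that asym by (auto simp: doubleton_eq_iff)
  then show "orientation (pverts D) ?E D"
    unfolding orientation_def by blast
qed

lemma oriented_graph_iff:
  "oriented_graph D \<longleftrightarrow> finite (pverts D) \<and> parcs D \<subseteq> pverts D \<times> pverts D \<and>
     (\<forall>u v. (u, v) \<in> parcs D \<longrightarrow> (v, u) \<notin> parcs D)"
proof
  assume "oriented_graph D"
  then obtain V E where "simple_graph V E" "orientation V E D"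
    unfolding oriented_graph_def by blast
  from orientation_imp_asymmetric[OF this] show
    "finite (pverts D) \<and> parcs D \<subseteq> pverts D \<times> pverts D \<and>
     (\<forall>u v. (u, v) \<in> parcs D \<longrightarrow> (v, u) \<notin> parcs D)" by simp
next
  assume "finite (pverts D) \<and> parcs D \<subseteq> pverts D \<times> pverts D \<and>
     (\<forall>u v. (u, v) \<in> parcs D \<longrightarrow> (v, u) \<notin> parcs D)"
  then show "oriented_graph D"
    using asymmetric_imp_orientation[of D] unfolding oriented_graph_def by blast
qed

lemma finite_parcs: "oriented_graph D \<Longrightarrow> finite (parcs D)"
  unfolding oriented_graph_iff by (meson finite_SigmaI finite_subset)

lemma min_edges_conv_arcs:
  "min_edges n k = Inf {enat (card (parcs D)) | D :: nat pair_pre_digraph.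
     oriented_graph D \<and> property_S k D \<and> card (pverts D) = n}"
proof -
  have "(\<exists>V D. simple_graph V E \<and> card V = n \<and> orientation V E D \<and> property_S k D) \<longleftrightarrow>
    (\<exists>D. simple_graph (pverts D) E \<and> orientation (pverts D) E D \<and> card E = card (parcs D) \<and>
      property_S k D \<and> card (pverts D) = n)" for E :: "nat set set"
    by (metis card_edges_eq_card_arcs orientation_imp_asymmetric(2))
  moreover have "(\<exists>E. simple_graph (pverts D) E \<and> orientation (pverts D) E D \<and>
      card E = card (parcs D)) \<longleftrightarrow> oriented_graph D" for D :: "nat pair_pre_digraph"
    unfolding oriented_graph_def
    by (metis card_edges_eq_card_arcs orientation_imp_asymmetric(2))
  ultimately have "{enat (card E) | E. \<exists>(V :: nat set) D. simple_graph V E \<and> card V = n \<and>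
       orientation V E D \<and> property_S k D} =
     {enat (card (parcs D)) | D :: nat pair_pre_digraph.
       oriented_graph D \<and> property_S k D \<and> card (pverts D) = n}"
    by (smt (verit) Collect_cong)
  then show ?thesis by (simp add: min_edges_def)
qed

section \<open>Indegrees\<close>

lemma in_degree_conv_preds: "in_degree (with_proj D) v = card {u. (u, v) \<in> parcs D}"
proof -
  have "in_arcs (with_proj D) v = (\<lambda>u. (u, v)) ` {u. (u, v) \<in> parcs D}"
    by (auto simp: in_arcs_def)
  then show ?thesis
    by (simp add: in_degree_def card_image inj_on_def)
qed

lemma card_arcs_eq_sum_in_degree:
  assumes "oriented_graph D"
  shows "card (parcs D) = (\<Sum>v\<in>pverts D. in_degree (with_proj D) v)"
proof -
  have "parcs D = (\<Union>v\<in>pverts D. in_arcs (with_proj D) v)"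
    using assms by (auto simp: in_arcs_def oriented_graph_iff)
  moreover have "card (\<Union>v\<in>pverts D. in_arcs (with_proj D) v) =
      (\<Sum>v\<in>pverts D. card (in_arcs (with_proj D) v))"
    using assms finite_parcs[OF assms]
    by (intro card_UN_disjoint) (auto simp: oriented_graph_iff in_arcs_def)
  ultimately show ?thesis by (simp add: in_degree_def)
qed

text \<open>Sets with fewer than \<open>k\<close> elements are padded to size \<open>k\<close>
  inside the vertex set, which is large enough. Singletons and folded sets below need this
  form.\<close>

lemma property_S_dominator:
  assumes "oriented_graph D" "property_S k D" "B \<subseteq> pverts D" "card B \<le> k"
  obtains u where "u \<in> pverts D" "\<And>v. v \<in> B \<Longrightarrow> (u, v) \<in> parcs D"
proof -
  have "finite (pverts D)" "k + 1 \<le> card (pverts D)"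
    using assms by (auto simp: oriented_graph_iff property_S_def)
  then obtain C where "B \<subseteq> C" "C \<subseteq> pverts D" "card C = k"
    using assms exists_subset_between[of B k "pverts D"] by auto
  moreover from this obtain u where "u \<in> pverts D" "C \<subseteq> out_neighbourhood D u"
    using assms(2) unfolding property_S_def by blast
  ultimately show ?thesis
    by (intro that[of u]) (auto simp: out_neighbourhood_def)
qed

text \<open>Dominating \<open>{v}\<close> gives an inneighbour. Hence the condition
  \<open>0 < \<delta>\<close> in \<open>min_indegree\<close> excludes no vertex when
  \<open>k \<ge> 1\<close>.\<close>

lemma property_S_in_degree_pos:
  assumes "oriented_graph D" "property_S k D" "k \<ge> 1" "v \<in> pverts D"
  shows "in_degree (with_proj D) v > 0"
proof -
  obtain u where "(u, v) \<in> parcs D"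
    using property_S_dominator[OF assms(1,2), of "{v}"] assms by auto
  moreover have "finite {u. (u, v) \<in> parcs D}"
    using assms(1) by (auto simp: oriented_graph_iff intro: finite_subset[of _ "pverts D"])
  ultimately show ?thesis by (auto simp: in_degree_conv_preds card_gt_0_iff)
qed

lemma min_indegree_le:
  fixes D :: "nat pair_pre_digraph"
  assumes "oriented_graph D" "property_S k D" "k \<ge> 1" "v \<in> pverts D"
  shows "min_indegree k \<le> in_degree (with_proj D) v"
  unfolding min_indegree_def
  by (rule Least_le, intro conjI exI[of _ D] exI[of _ v])
    (use assms property_S_in_degree_pos[OF assms] in simp_all)

text \<open>Applied below with \<open>d = \<delta>\<close> for the linear lower bound, and with
  \<open>d = Suc \<delta>\<close> to force a vertex of minimum indegree.\<close>

lemma card_arcs_ge: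
  assumes "oriented_graph D" "\<And>v. v \<in> pverts D \<Longrightarrow> d \<le> in_degree (with_proj D) v"
  shows "d * card (pverts D) \<le> card (parcs D)"
  using sum_bounded_below[of "pverts D" d "in_degree (with_proj D)", OF assms(2)]
  by (simp add: card_arcs_eq_sum_in_degree[OF assms(1)] mult.commute)

section \<open>Twinning a vertex\<close>

definition add_twin :: "'a \<Rightarrow> 'a \<Rightarrow> 'a pair_pre_digraph \<Rightarrow> 'a pair_pre_digraph" where
  "add_twin v w D = \<lparr>pverts = insert w (pverts D),
     parcs = parcs D \<union> (\<lambda>u. (u, w)) ` {u. (u, v) \<in> parcs D}\<rparr>"

lemma add_twin:
  assumes D: "oriented_graph D" "property_S k D" and v: "v \<in> pverts D" and w: "w \<notin> pverts D"
  shows oriented_graph_add_twin: "oriented_graph (add_twin v w D)"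
    and property_S_add_twin: "property_S k (add_twin v w D)"
    and card_pverts_add_twin: "card (pverts (add_twin v w D)) = Suc (card (pverts D))"
    and card_parcs_add_twin:
      "card (parcs (add_twin v w D)) = card (parcs D) + in_degree (with_proj D) v"
    and in_degree_add_twin:
      "in_degree (with_proj (add_twin v w D)) v = in_degree (with_proj D) v"
proof -
  have fin: "finite (pverts D)" and sub: "parcs D \<subseteq> pverts D \<times> pverts D"
    using D(1) by (auto simp: oriented_graph_iff)
  have no_w: "(u, w) \<notin> parcs D" "(w, u) \<notin> parcs D" for u
    using sub w by auto
  show "oriented_graph (add_twin v w D)"
    using D(1) v w no_w by (auto simp: oriented_graph_iff add_twin_def)
  show card_V: "card (pverts (add_twin v w D)) = Suc (card (pverts D))"
    using fin w by (simp add: add_twin_def)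
  have "finite {u. (u, v) \<in> parcs D}"
    using fin sub by (auto intro: finite_subset[of _ "pverts D"])
  then show "card (parcs (add_twin v w D)) = card (parcs D) + in_degree (with_proj D) v"
    using no_w finite_parcs[OF D(1)]
    by (simp add: add_twin_def in_degree_conv_preds)
      (subst card_Un_disjoint, auto simp: card_image inj_on_def)
  show "in_degree (with_proj (add_twin v w D)) v = in_degree (with_proj D) v"
    using v w by (auto simp: in_degree_conv_preds add_twin_def intro!: arg_cong[where f = card])
  have "\<exists>u\<in>pverts (add_twin v w D). B \<subseteq> out_neighbourhood (add_twin v w D) u"
    if B: "B \<subseteq> pverts (add_twin v w D)" "card B = k" for B
  proof -
    \<comment> \<open>Fold the twin back onto \<open>v\<close>. If \<open>B\<close> contains both,
      its image has fewer than \<open>k\<close> elements, but any dominator of the image still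
      dominates \<open>B\<close>.\<close>
    define f where "f x = (if x = w then v else x)" for x
    have "finite B"
      using B(1) fin by (auto simp: add_twin_def intro: finite_subset)
    then have "card (f ` B) \<le> k"
      using B(2) card_image_le by blast
    moreover have "f ` B \<subseteq> pverts D"
      using B(1) v by (auto simp: f_def add_twin_def)
    ultimately obtain u where u: "u \<in> pverts D" "\<And>x. x \<in> f ` B \<Longrightarrow> (u, x) \<in> parcs D"
      using property_S_dominator[OF D] by blast
    have "(u, x) \<in> parcs (add_twin v w D)" if "x \<in> B" for x
      using u(2)[OF imageI[OF that]] by (auto simp: f_def add_twin_def split: if_splits)
    then have "B \<subseteq> out_neighbourhood (add_twin v w D) u"
      by (auto simp: out_neighbourhood_def)
    moreover have "u \<in> pverts (add_twin v w D)"
      using u(1) by (simp add: add_twin_def)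
    ultimately show ?thesis by blast
  qed
  then show "property_S k (add_twin v w D)"
    using D(2) card_V by (simp add: property_S_def)
qed

text \<open>A fresh vertex exists because \<open>nat\<close> is infinite. Retaining \<open>v\<close>
  and its indegree lets the step be repeated.\<close>

lemma ex_add_twin:
  fixes D :: "nat pair_pre_digraph"
  assumes "oriented_graph D" "property_S k D" "v \<in> pverts D"
  shows "\<exists>D' :: nat pair_pre_digraph. oriented_graph D' \<and> property_S k D' \<and> v \<in> pverts D' \<and>
    in_degree (with_proj D') v = in_degree (with_proj D) v \<and>
    card (pverts D') = Suc (card (pverts D)) \<and>
    card (parcs D') = card (parcs D) + in_degree (with_proj D) v"
proof -
  obtain w where "w \<notin> pverts D"
    using assms(1) ex_new_if_finite[OF infinite_UNIV_nat, of "pverts D"]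
    unfolding oriented_graph_iff by blast
  from add_twin[OF assms this] assms(3) show ?thesis
    by (intro exI[of _ "add_twin v w D"]) (simp add: add_twin_def)
qed

lemma ex_add_twins:
  fixes D :: "nat pair_pre_digraph"
  assumes "oriented_graph D" "property_S k D" "v \<in> pverts D"
  shows "\<exists>D' :: nat pair_pre_digraph. oriented_graph D' \<and> property_S k D' \<and> v \<in> pverts D' \<and>
    in_degree (with_proj D') v = in_degree (with_proj D) v \<and>
    card (pverts D') = card (pverts D) + m \<and>
    card (parcs D') = card (parcs D) + in_degree (with_proj D) v * m"
proof (induction m)
  case 0
  then show ?case using assms by auto
next
  case (Suc m)
  then obtain D' :: "nat pair_pre_digraph" where D': "oriented_graph D'" "property_S k D'"
      "v \<in> pverts D'" "in_degree (with_proj D') v = in_degree (with_proj D) v"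
      "card (pverts D') = card (pverts D) + m"
      "card (parcs D') = card (parcs D) + in_degree (with_proj D) v * m"
    by blast
  then show ?case
    using ex_add_twin[OF D'(1-3)] by auto
qed

section \<open>Existence of oriented graphs with property \<open>S\<^sub>k\<close>\<close>

lemma ex_property_S: "\<exists>D :: nat pair_pre_digraph. oriented_graph D \<and> property_S k D"
proof -
  \<comment> \<open>There are \<open>k * k + 1\<close> labels, one more than \<open>k\<close> sets
    of size at most \<open>k\<close> can cover.\<close>
  define V where "V = {..k * k} \<times> {K. K \<subseteq> {..k * k} \<and> card K \<le> k}"
  define c where "c = (\<lambda>(s, K). prod_encode (s, set_encode K))"
  define A where "A = {((s, K), (t, L)) | s K t L. (s, K) \<in> V \<and> (t, L) \<in> V \<and> t \<in> K \<and> s \<notin> L}"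
  define D where "D = \<lparr>pverts = c ` V, parcs = map_prod c c ` A\<rparr>"
  \<comment> \<open>Needed for injectivity of \<open>c\<close>, since \<open>set_encode\<close> is
    injective only on finite sets.\<close>
  have finK: "finite K" if "(s, K) \<in> V" for s K
    using that finite_subset[of K "{..k * k}"] by (auto simp: V_def)
  then have inj: "inj_on c V"
    by (auto simp: inj_on_def c_def set_encode_eq prod_encode_eq)
  have finV: "finite V"
    by (auto simp: V_def)
  \<comment> \<open>An arc from \<open>(s, K)\<close> to \<open>(t, L)\<close> requires
    \<open>s \<notin> L\<close>, whereas its reverse would require \<open>s \<in> L\<close>.\<close>
  have asym: "(y, x) \<notin> A" if "(x, y) \<in> A" for x y
    using that by (auto simp: A_def)
  have A_sub: "A \<subseteq> V \<times> V" by (auto simp: A_def)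
  have "(y, x) \<notin> parcs D" if xy: "(x, y) \<in> parcs D" for x y
  proof
    assume "(y, x) \<in> parcs D"
    then obtain b' a' where 1: "(b', a') \<in> A" "y = c b'" "x = c a'" by (auto simp: D_def)
    obtain a b where 2: "(a, b) \<in> A" "x = c a" "y = c b" using xy by (auto simp: D_def)
    have "a' = a" "b' = b" using 1 2 inj A_sub by (auto simp: inj_on_def)
    then show False using 1 2 asym by blast
  qed
  then have "oriented_graph D"
    using finV A_sub by (fastforce simp: oriented_graph_iff D_def)
  moreover have "property_S k D"
    unfolding property_S_def
  proof (intro conjI allI impI)
    have "(\<lambda>s. (s, {})) ` {..k * k} \<subseteq> V" by (auto simp: V_def)
    then have "card ((\<lambda>s. (s, {} :: nat set)) ` {..k * k}) \<le> card V"
      by (intro card_mono finV)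
    then have "k * k + 1 \<le> card V" by (simp add: card_image inj_on_def)
    moreover have "k \<le> k * k" by (cases k) auto
    moreover have "card (pverts D) = card V"
      using inj by (simp add: D_def card_image)
    ultimately show "k + 1 \<le> card (pverts D)" by linarith
  next
    fix B assume B: "B \<subseteq> pverts D \<and> card B = k"
    then obtain C where C: "C \<subseteq> V" "B = c ` C"
      by (auto simp: D_def subset_image_iff)
    then have cardC: "card C = k" and finC: "finite C"
      using B inj finV by (auto simp: card_image inj_on_subset intro: finite_subset)
    have "card (\<Union>(snd ` C)) \<le> (\<Sum>x\<in>C. card (snd x))"
      using card_UN_le[OF finC, of snd] by simp
    also have "\<dots> \<le> (\<Sum>x\<in>C. k)"
      using C(1) by (intro sum_mono) (auto simp: V_def)
    finally have "card (\<Union>(snd ` C)) < card {..k * k}" by (simp add: cardC)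
    moreover have "finite (\<Union>(snd ` C))" using C(1) finC finK by fastforce
    ultimately obtain s where s: "s \<le> k * k" "s \<notin> \<Union>(snd ` C)"
      by (metis atMost_iff card_mono leD subsetI)
    let ?u = "(s, fst ` C)"
    have "card (fst ` C) \<le> k"
      using card_image_le[OF finC, of fst] cardC by simp
    then have u: "?u \<in> V" using C(1) s(1) by (auto simp: V_def)
    have arc: "(?u, x) \<in> A" if "x \<in> C" for x
    proof -
      have "x = (fst x, snd x)" "(fst x, snd x) \<in> V" "fst x \<in> fst ` C" "s \<notin> snd x"
        using that C(1) s(2) by auto
      then show ?thesis unfolding A_def using u by blast
    qed
    have "(c ?u, c x) \<in> parcs D" if "x \<in> C" for x
      using map_prod_imageI[OF arc[OF that], of c c] by (simp add: D_def)
    then have "B \<subseteq> out_neighbourhood D (c ?u)"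
      by (auto simp: out_neighbourhood_def C(2))
    moreover have "c ?u \<in> pverts D" using u by (auto simp: D_def)
    ultimately show "\<exists>u\<in>pverts D. B \<subseteq> out_neighbourhood D u" by blast
  qed
  ultimately show ?thesis by blast
qed

text \<open>The construction above supplies a candidate, so the \<open>LEAST\<close> in
  \<open>min_indegree\<close> is a true minimum.\<close>

lemma min_indegree_attained:
  assumes "k \<ge> 1"
  obtains D :: "nat pair_pre_digraph" and v where "oriented_graph D" "property_S k D"
    "v \<in> pverts D" "in_degree (with_proj D) v = min_indegree k"
proof -
  obtain D :: "nat pair_pre_digraph" where D: "oriented_graph D" "property_S k D"
    using ex_property_S by blast
  then have "pverts D \<noteq> {}" by (auto simp: property_S_def)
  then obtain v where v: "v \<in> pverts D" by blast
  let ?P = "\<lambda>\<delta>. 0 < \<delta> \<and> (\<exists>(D :: nat pair_pre_digraph) v. oriented_graph D \<and> property_S k D \<and>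
        v \<in> pverts D \<and> in_degree (with_proj D) v = \<delta>)"
  have "?P (in_degree (with_proj D) v)"
    using D v property_S_in_degree_pos[OF D assms v] by blast
  then have "?P (min_indegree k)"
    unfolding min_indegree_def by (rule LeastI)
  then show ?thesis using that by blast
qed

section \<open>Linear growth of the minimum\<close>

text \<open>Choose \<open>M\<close> where \<open>g\<close> is least on \<open>n \<ge> N\<close>:
  from there on it can neither rise nor drop.\<close>

lemma eventually_constant_if_nonincreasing:
  fixes g :: "nat \<Rightarrow> nat"
  assumes "\<And>n. n \<ge> N \<Longrightarrow> g (Suc n) \<le> g n"
  obtains M where "M \<ge> N" "\<And>n. n \<ge> M \<Longrightarrow> g n = g M"
proof -
  obtain M where M: "M \<ge> N" "\<And>n. n \<ge> N \<Longrightarrow> g M \<le> g n"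
    using ex_has_least_nat[of "\<lambda>n. n \<ge> N" N g] by blast
  have "g n \<le> g M" if "n \<ge> M" for n
    using that
  proof (induction n rule: dec_induct)
    case (step n)
    then show ?case using assms[of n] M(1) by simp
  qed simp
  with M show ?thesis
    by (intro that[of M]) (auto intro: antisym)
qed

theorem lemma5:
  fixes k :: nat
  assumes "k \<ge> 2"
  shows "\<exists>(c :: int) (n\<^sub>0 :: nat). \<forall>n \<ge> n\<^sub>0.
           \<exists>m :: nat. min_edges n k = enat m \<and> int m = int (min_indegree k) * int n + c"
proof -
  have k1: "k \<ge> 1" using assms by simp
  define \<delta> where "\<delta> = min_indegree k"
  define G where "G n m \<longleftrightarrow> (\<exists>D :: nat pair_pre_digraph. oriented_graph D \<and> property_S k D \<and>
    card (pverts D) = n \<and> card (parcs D) = m)" for n m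
  \<comment> \<open>This is a finite version of \<open>min_edges\<close>, meaningful once some
    \<open>G n m\<close> holds; \<open>upper\<close> ensures that for
    \<open>n \<ge> n0\<close>.\<close>
  define f where "f n = (LEAST m. G n m)" for n
  obtain D0 :: "nat pair_pre_digraph" and v0 where D0: "oriented_graph D0" "property_S k D0"
      "v0 \<in> pverts D0" "in_degree (with_proj D0) v0 = \<delta>"
    using min_indegree_attained[OF k1] unfolding \<delta>_def by blast
  define n0 where "n0 = card (pverts D0)"
  define e0 where "e0 = card (parcs D0)"
  have upper: "G n (e0 + \<delta> * (n - n0))" if "n \<ge> n0" for n
    using ex_add_twins[OF D0(1-3), of "n - n0"] that
    by (auto simp: G_def n0_def e0_def D0(4))
  have f_le: "f n \<le> m" if "G n m" for n m
    unfolding f_def using that by (rule Least_le)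
  have G_f: "G n (f n)" if "n \<ge> n0" for n
    unfolding f_def using upper[OF that] by (rule LeastI)
  have F: "min_edges n k = enat (f n)" if "n \<ge> n0" for n
  proof -
    have "min_edges n k = Inf {enat m | m. G n m}"
      unfolding min_edges_conv_arcs G_def by (rule arg_cong[where f = Inf]) blast
    also have "\<dots> = enat (f n)"
      using G_f[OF that] f_le by (intro cInf_eq_minimum) auto
    finally show ?thesis .
  qed
  have f_ge: "\<delta> * n \<le> f n" if "n \<ge> n0" for n
    using G_f[OF that] card_arcs_ge min_indegree_le[OF _ _ k1] unfolding G_def \<delta>_def by metis
  have f_Suc: "f (Suc n) \<le> f n + \<delta>" if n: "n \<ge> n0" "n > e0" for n
  proof -
    obtain D :: "nat pair_pre_digraph" where D: "oriented_graph D" "property_S k D"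
        "card (pverts D) = n" "card (parcs D) = f n"
      using G_f[OF n(1)] unfolding G_def by blast
    \<comment> \<open>Otherwise all indegrees exceed \<open>\<delta>\<close>, and the surplus of at
      least \<open>n\<close> arcs contradicts the upper bound, whose excess over
      \<open>\<delta> * n\<close> is at most \<open>e0 < n\<close>.\<close>
    have "\<exists>v\<in>pverts D. in_degree (with_proj D) v = \<delta>"
    proof (rule ccontr)
      assume "\<not> ?thesis"
      then have "Suc \<delta> \<le> in_degree (with_proj D) v" if "v \<in> pverts D" for v
        using min_indegree_le[OF D(1,2) k1 that] that unfolding \<delta>_def
        by (metis Suc_leI le_neq_implies_less)
      then have "Suc \<delta> * n \<le> f n"
        using card_arcs_ge[OF D(1), of "Suc \<delta>"] D by simp
      moreover have "f n \<le> e0 + \<delta> * (n - n0)"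
        using f_le upper n(1) by blast
      moreover have "\<delta> * (n - n0) \<le> \<delta> * n" by simp
      ultimately have "\<delta> * n + n \<le> e0 + \<delta> * n"
        by (simp only: mult_Suc)
      then show False using n(2) by simp
    qed
    then obtain v where v: "v \<in> pverts D" "in_degree (with_proj D) v = \<delta>" by blast
    have "G (Suc n) (f n + \<delta>)"
      using ex_add_twin[OF D(1,2) v(1)] D(3,4) v(2) unfolding G_def by auto
    then show ?thesis by (rule f_le)
  qed
  define N where "N = max n0 (Suc e0)"
  \<comment> \<open>Truncated subtraction keeps this inequality valid; \<open>f_ge\<close> later
    shows that nothing is truncated.\<close>
  have "f (Suc n) - \<delta> * Suc n \<le> f n - \<delta> * n" if "n \<ge> N" for n
    using f_Suc[of n] that by (simp add: N_def)
  from eventually_constant_if_nonincreasing[of N "\<lambda>n. f n - \<delta> * n", OF this]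
  obtain M where M: "M \<ge> N" "\<And>n. n \<ge> M \<Longrightarrow> f n - \<delta> * n = f M - \<delta> * M"
    by blast
  have "min_edges n k = enat (f n) \<and> int (f n) = int (min_indegree k) * int n + int (f M - \<delta> * M)"
    if "n \<ge> M" for n
  proof -
    have "n \<ge> n0" using that M(1) by (simp add: N_def)
    then have "f n = \<delta> * n + (f M - \<delta> * M)"
      using f_ge[of n] M(2)[OF that] by simp
    then have "int (f n) = int \<delta> * int n + int (f M - \<delta> * M)"
      by (metis of_nat_add of_nat_mult)
    then show ?thesis using F[OF \<open>n \<ge> n0\<close>] by (simp add: \<delta>_def)
  qed
  then show ?thesis by blast
qed

end
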